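(* Let $n\ge 1$, let $\alpha_1\le\alpha_2\le\cdots\le\alpha_n$ be real numbers and let $\bar x_1,\dots,\bar x_n\ge 0$ be real numbers. Let $j^*\in\{1,\dots,n\}$ be such that $\lambda_{j^*}\le 0$ and $\lambda_{j^*+1}\ge 0$, where $$\lambda_j=\sum_{i=1}^{j-1}\bar x_i-\sum_{i=j}^{n}\bar x_i,\qquad j=1,\dots,n+1 .$$ Define $$\alpha_0^*=\alpha_{j^*},\qquad \beta_0^*=\frac12\sum_{j=1}^n(\alpha_j-\alpha_0^* )\,\bar x_j .$$ Then $(\alpha_0^*,\beta_0^* )$ is a globally optimal solution of the minimax problem $$\min_{(\alpha_0,\beta_0)\in\mathbb{R}^2}\ \max_{\substack{0\le x_j\le\bar x_j\\ j=1,\dots,n}}\ \left|\sum_{j=1}^n\alpha_jx_j-\alpha_0\Big(\sum_{j=1}^n x_j\Big)-\beta_0\right| .$$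
   Context: Empty sums are zero. An index $j^*$ with $\lambda_{j^*}\le 0\le\lambda_{j^*+1}$ always exists. "Globally optimal solution" means that the inner maximum, viewed as a function of $(\alpha_0,\beta_0)\in\mathbb{R}^2$, attains its minimum over $\mathbb{R}^2$ at $(\alpha_0^*,\beta_0^* )$. *)

theory Defs
  imports Complex_Main "HOL-Library.FuncSet"
begin

definition lam :: "nat \<Rightarrow> (nat \<Rightarrow> real) \<Rightarrow> nat \<Rightarrow> real" where
  "lam n xbar j = (\<Sum>i\<in>{1..<j}. xbar i) - (\<Sum>i\<in>{j..n}. xbar i)"

text \<open>Vectors in \<open>\<real>\<^sup>n\<close> are functions on \<open>{1..n}\<close>, represented as extensional functions on \<open>nat\<close>.\<close>

definition feasible :: "nat \<Rightarrow> (nat \<Rightarrow> real) \<Rightarrow> (nat \<Rightarrow> real) set" where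
  "feasible n xbar = (\<Pi>\<^sub>E j\<in>{1..n}. {0..xbar j})"

definition approx_error ::
  "nat \<Rightarrow> (nat \<Rightarrow> real) \<Rightarrow> real \<Rightarrow> real \<Rightarrow> (nat \<Rightarrow> real) \<Rightarrow> real" where
  "approx_error n \<alpha> \<alpha>0 \<beta>0 x =
     \<bar>(\<Sum>j=1..n. \<alpha> j * x j) - \<alpha>0 * (\<Sum>j=1..n. x j) - \<beta>0\<bar>"

text \<open>The supremum below is a maximum: see \<open>max_error_attained\<close> and \<open>approx_error_le_max_error\<close>.\<close>

definition max_error ::
  "nat \<Rightarrow> (nat \<Rightarrow> real) \<Rightarrow> (nat \<Rightarrow> real) \<Rightarrow> real \<Rightarrow> real \<Rightarrow> real" where
  "max_error n \<alpha> xbar \<alpha>0 \<beta>0 = (SUP x\<in>feasible n xbar. approx_error n \<alpha> \<alpha>0 \<beta>0 x)"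

lemma approx_error_has_max:
  assumes "\<And>j. j \<in> {1..n} \<Longrightarrow> 0 \<le> xbar j"
  shows "\<exists>x\<in>feasible n xbar. \<forall>y\<in>feasible n xbar. approx_error n \<alpha> \<alpha>0 \<beta>0 y \<le> approx_error n \<alpha> \<alpha>0 \<beta>0 x"
proof -
  let ?S = "\<lambda>x. \<Sum>j=1..n. (\<alpha> j - \<alpha>0) * x j"
  have E: "approx_error n \<alpha> \<alpha>0 \<beta>0 x = \<bar>?S x - \<beta>0\<bar>" for x
    by (simp add: approx_error_def left_diff_distrib sum_subtractf sum_distrib_left)
  define u where "u = restrict (\<lambda>j. if \<alpha> j \<ge> \<alpha>0 then xbar j else 0) {1..n}"
  define l where "l = restrict (\<lambda>j. if \<alpha> j \<ge> \<alpha>0 then 0 else xbar j) {1..n}"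
  have ul: "u \<in> feasible n xbar" "l \<in> feasible n xbar"
    using assms by (auto simp: u_def l_def feasible_def)
  have bnd: "?S l \<le> ?S y \<and> ?S y \<le> ?S u" if "y \<in> feasible n xbar" for y
  proof -
    have y: "0 \<le> y j" "y j \<le> xbar j" if "j \<in> {1..n}" for j
      using \<open>y \<in> feasible n xbar\<close> that by (auto simp: feasible_def dest: PiE_mem)
    show ?thesis
      by (intro conjI sum_mono)
        (use y in \<open>auto simp: u_def l_def mult_left_mono mult_left_mono_neg mult_nonneg_nonneg
           mult_nonpos_nonneg\<close>)
  qed
  have "approx_error n \<alpha> \<alpha>0 \<beta>0 y \<le> max (approx_error n \<alpha> \<alpha>0 \<beta>0 l) (approx_error n \<alpha> \<alpha>0 \<beta>0 u)"
    if "y \<in> feasible n xbar" for y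
    using bnd[OF that] unfolding E by linarith
  then show ?thesis
    using ul by (metis max_def)
qed

lemma max_error_attained:
  assumes "\<And>j. j \<in> {1..n} \<Longrightarrow> 0 \<le> xbar j"
  shows "\<exists>x\<in>feasible n xbar. approx_error n \<alpha> \<alpha>0 \<beta>0 x = max_error n \<alpha> xbar \<alpha>0 \<beta>0"
proof -
  obtain x where x: "x \<in> feasible n xbar"
    "\<And>y. y \<in> feasible n xbar \<Longrightarrow> approx_error n \<alpha> \<alpha>0 \<beta>0 y \<le> approx_error n \<alpha> \<alpha>0 \<beta>0 x"
    using approx_error_has_max[of n xbar \<alpha> \<alpha>0 \<beta>0] assms by blast
  have "max_error n \<alpha> xbar \<alpha>0 \<beta>0 = approx_error n \<alpha> \<alpha>0 \<beta>0 x"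
    unfolding max_error_def by (rule cSup_eq_maximum) (use x in auto)
  with x show ?thesis by auto
qed

lemma approx_error_le_max_error:
  assumes "\<And>j. j \<in> {1..n} \<Longrightarrow> 0 \<le> xbar j" and "x \<in> feasible n xbar"
  shows "approx_error n \<alpha> \<alpha>0 \<beta>0 x \<le> max_error n \<alpha> xbar \<alpha>0 \<beta>0"
proof -
  have "bdd_above (approx_error n \<alpha> \<alpha>0 \<beta>0 ` feasible n xbar)"
    using approx_error_has_max[of n xbar \<alpha> \<alpha>0 \<beta>0] assms(1) by (force simp: bdd_above_def)
  then show ?thesis
    unfolding max_error_def by (rule cSUP_upper[OF assms(2)])
qed

end

theory Submission
  imports Defs
begin

text \<open>
  Write \<open>S x = (\<Sum>j. (\<alpha> j - a) * x j)\<close>, so that the error at \<open>(a, b)\<close> is \<open>\<bar>S x - b\<bar>\<close>. Over the box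
  \<open>0 \<le> x j \<le> xbar j\<close> the linear form \<open>S\<close> runs through an interval whose ends are reached by switching
  each coordinate fully on or off according to the sign of its coefficient. The length of that interval
  is the weighted deviation \<open>D a = (\<Sum>j. \<bar>\<alpha> j - a\<bar> * xbar j)\<close>, and its midpoint is the value of \<open>S\<close> at the
  centre of the box, that is, half its value at \<open>xbar\<close>. A point \<open>b\<close> is at distance at least \<open>D a / 2\<close>
  from one of the two ends (\<open>max_error_lower_bound\<close>), and the midpoint is at distance at most \<open>D a / 2\<close>
  from the whole interval (\<open>max_error_midpoint\<close>).

  So the best \<open>b\<close> for a given \<open>a\<close> is the midpoint, which is the formula for \<open>\<beta>0s\<close>, and it remains to
  minimise \<open>D\<close>. Its minimisers are the weighted medians of the \<open>\<alpha> j\<close>: \<open>D\<close> is convex and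
  piecewise linear, and \<open>lam n xbar jstar\<close> and \<open>lam n xbar (jstar + 1)\<close> are both subgradients of \<open>D\<close> at
  \<open>\<alpha> jstar\<close> (\<open>weighted_deviation_subgradient\<close>). One is nonpositive and the other nonnegative, so neither
  direction leads to a smaller value (\<open>weighted_deviation_minimal\<close>).
\<close>

definition weighted_deviation :: "nat \<Rightarrow> (nat \<Rightarrow> real) \<Rightarrow> (nat \<Rightarrow> real) \<Rightarrow> real \<Rightarrow> real" where
  "weighted_deviation n \<alpha> xbar a = (\<Sum>j=1..n. \<bar>\<alpha> j - a\<bar> * xbar j)"

lemma approx_error_centered:
  "approx_error n \<alpha> a b x = \<bar>(\<Sum>j=1..n. (\<alpha> j - a) * x j) - b\<bar>"
  by (simp add: approx_error_def left_diff_distrib sum_subtractf sum_distrib_left)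

text \<open>
  The two ends of the range of the linear form differ by \<open>weighted_deviation n \<alpha> xbar a\<close>, so by the
  triangle inequality they cannot both be closer to \<open>b\<close> than half of it.
\<close>

lemma max_error_lower_bound:
  assumes nonneg: "\<And>j. j \<in> {1..n} \<Longrightarrow> 0 \<le> xbar j"
  shows "weighted_deviation n \<alpha> xbar a / 2 \<le> max_error n \<alpha> xbar a b"
proof -
  let ?S = "\<lambda>x. \<Sum>j=1..n. (\<alpha> j - a) * x j"
  define u where "u = restrict (\<lambda>j. if a \<le> \<alpha> j then xbar j else 0) {1..n}"
  define l where "l = restrict (\<lambda>j. if a \<le> \<alpha> j then 0 else xbar j) {1..n}"
  have "u \<in> feasible n xbar" "l \<in> feasible n xbar"
    using nonneg by (auto simp: u_def l_def feasible_def)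
  then have "\<bar>?S u - b\<bar> \<le> max_error n \<alpha> xbar a b" "\<bar>?S l - b\<bar> \<le> max_error n \<alpha> xbar a b"
    using approx_error_le_max_error[of n xbar _ \<alpha> a b] nonneg
    unfolding approx_error_centered by blast+
  moreover have "?S u - ?S l = weighted_deviation n \<alpha> xbar a"
    unfolding weighted_deviation_def sum_subtractf[symmetric]
    by (intro sum.cong) (auto simp: u_def l_def algebra_simps)
  ultimately show ?thesis
    by linarith
qed

text \<open>
  Measured from the centre of the box, coordinate \<open>j\<close> of a feasible point is at most \<open>xbar j / 2\<close> in
  absolute value, so the linear form departs from its value at the centre by at most half the
  weighted deviation.
\<close>

lemma max_error_midpoint:
  assumes nonneg: "\<And>j. j \<in> {1..n} \<Longrightarrow> 0 \<le> xbar j"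
  shows "max_error n \<alpha> xbar a (1 / 2 * (\<Sum>j=1..n. (\<alpha> j - a) * xbar j))
           \<le> weighted_deviation n \<alpha> xbar a / 2"
proof -
  let ?m = "1 / 2 * (\<Sum>j=1..n. (\<alpha> j - a) * xbar j)"
  obtain x where x: "x \<in> feasible n xbar" "approx_error n \<alpha> a ?m x = max_error n \<alpha> xbar a ?m"
    using max_error_attained[of n xbar \<alpha> a ?m] nonneg by blast
  have "(\<Sum>j=1..n. (\<alpha> j - a) * x j) - ?m = (\<Sum>j=1..n. (\<alpha> j - a) * (x j - xbar j / 2))"
    by (simp add: right_diff_distrib sum_subtractf sum_divide_distrib)
  moreover have "\<bar>\<Sum>j=1..n. (\<alpha> j - a) * (x j - xbar j / 2)\<bar> \<le> (\<Sum>j=1..n. \<bar>\<alpha> j - a\<bar> * (xbar j / 2))"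
  proof (rule sum_abs[THEN order_trans], rule sum_mono)
    fix j assume "j \<in> {1..n}"
    then have "0 \<le> x j" "x j \<le> xbar j"
      using x(1) by (auto simp: feasible_def dest: PiE_mem)
    then show "\<bar>(\<alpha> j - a) * (x j - xbar j / 2)\<bar> \<le> \<bar>\<alpha> j - a\<bar> * (xbar j / 2)"
      unfolding abs_mult by (intro mult_left_mono) linarith+
  qed
  moreover have "(\<Sum>j=1..n. \<bar>\<alpha> j - a\<bar> * (xbar j / 2)) = weighted_deviation n \<alpha> xbar a / 2"
    by (simp add: weighted_deviation_def sum_divide_distrib)
  ultimately show ?thesis
    using x(2) unfolding approx_error_centered by linarith
qed

lemma lam_eq_signed_sum:
  assumes "k \<in> {1..n + 1}"
  shows "lam n xbar k = (\<Sum>j=1..n. (if j < k then 1 else - 1) * xbar j)"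
proof -
  have "{1..n} = {1..<k} \<union> {k..n}" "{1..<k} \<inter> {k..n} = {}"
    using assms by auto
  then show ?thesis
    by (simp add: lam_def sum.union_disjoint sum_negf)
qed

text \<open>
  If \<open>c\<close> separates the nodes with index below \<open>k\<close> from the others, then \<open>\<bar>\<alpha> j - c\<bar>\<close> equals
  \<open>\<sigma> j * (c - \<alpha> j)\<close> with \<open>\<sigma> j = 1\<close> for \<open>j < k\<close> and \<open>\<sigma> j = - 1\<close> otherwise. At any other point these signs only
  give a lower bound for the absolute value, and the resulting affine minorant has slope \<open>lam n xbar k\<close>.
\<close>

lemma weighted_deviation_subgradient:
  assumes nonneg: "\<And>j. j \<in> {1..n} \<Longrightarrow> 0 \<le> xbar j"
    and k: "k \<in> {1..n + 1}"
    and below: "\<And>j. j \<in> {1..n} \<Longrightarrow> j < k \<Longrightarrow> \<alpha> j \<le> c"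
    and above: "\<And>j. j \<in> {1..n} \<Longrightarrow> k \<le> j \<Longrightarrow> c \<le> \<alpha> j"
  shows "weighted_deviation n \<alpha> xbar c + (a - c) * lam n xbar k \<le> weighted_deviation n \<alpha> xbar a"
proof -
  let ?\<sigma> = "\<lambda>j. if j < k then 1 else - 1 :: real"
  have "weighted_deviation n \<alpha> xbar c + (a - c) * lam n xbar k
      = (\<Sum>j=1..n. (\<bar>\<alpha> j - c\<bar> + (a - c) * ?\<sigma> j) * xbar j)"
    unfolding lam_eq_signed_sum[OF k] weighted_deviation_def sum_distrib_left sum.distrib[symmetric]
    by (intro sum.cong) (auto simp: algebra_simps)
  also have "\<dots> \<le> weighted_deviation n \<alpha> xbar a"
    unfolding weighted_deviation_def
  proof (intro sum_mono mult_right_mono)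
    fix j assume j: "j \<in> {1..n}"
    show "\<bar>\<alpha> j - c\<bar> + (a - c) * ?\<sigma> j \<le> \<bar>\<alpha> j - a\<bar>"
      using below[OF j] above[OF j] by (cases "j < k") auto
  qed (use nonneg in auto)
  finally show ?thesis .
qed

text \<open>
  The node \<open>\<alpha> m\<close> may be counted on either side of itself, so both \<open>lam n xbar m\<close> and
  \<open>lam n xbar (m + 1)\<close> are subgradients there: the first controls points to the left of it, the second
  points to the right.
\<close>

lemma weighted_deviation_minimal:
  assumes mono: "mono_on {1..n} \<alpha>"
    and nonneg: "\<And>j. j \<in> {1..n} \<Longrightarrow> 0 \<le> xbar j"
    and m: "m \<in> {1..n}"
    and left: "lam n xbar m \<le> 0" and right: "0 \<le> lam n xbar (m + 1)"
  shows "weighted_deviation n \<alpha> xbar (\<alpha> m) \<le> weighted_deviation n \<alpha> xbar a"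
proof -
  have le: "\<alpha> i \<le> \<alpha> j" if "i \<in> {1..n}" "j \<in> {1..n}" "i \<le> j" for i j
    using mono that by (auto simp: mono_on_def)
  obtain k where k: "k \<in> {m, m + 1}" and slope: "0 \<le> (a - \<alpha> m) * lam n xbar k"
  proof (cases "a \<le> \<alpha> m")
    case True
    with left that[of m] show thesis
      by (simp add: mult_nonpos_nonpos)
  next
    case False
    with right that[of "m + 1"] show thesis
      by simp
  qed
  have "weighted_deviation n \<alpha> xbar (\<alpha> m) + (a - \<alpha> m) * lam n xbar k \<le> weighted_deviation n \<alpha> xbar a"
    by (rule weighted_deviation_subgradient) (use nonneg k m le in auto)
  with slope show ?thesis
    by linarith
qed

theorem theorem2:
  fixes n jstar :: nat and \<alpha> xbar :: "nat \<Rightarrow> real" and \<alpha>0s \<beta>0s :: real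
  assumes "n \<ge> 1"
    and "mono_on {1..n} \<alpha>"
    and "\<And>j. j \<in> {1..n} \<Longrightarrow> 0 \<le> xbar j"
    and "jstar \<in> {1..n}"
    and "lam n xbar jstar \<le> 0"
    and "lam n xbar (jstar + 1) \<ge> 0"
    and "\<alpha>0s = \<alpha> jstar"
    and "\<beta>0s = 1 / 2 * (\<Sum>j=1..n. (\<alpha> j - \<alpha>0s) * xbar j)"
  shows "is_arg_min (\<lambda>(\<alpha>0, \<beta>0). max_error n \<alpha> xbar \<alpha>0 \<beta>0) (\<lambda>p. p \<in> UNIV) (\<alpha>0s, \<beta>0s)"
proof -
  note nonneg = assms(3)
  have "max_error n \<alpha> xbar \<alpha>0s \<beta>0s \<le> max_error n \<alpha> xbar a b" for a b
  proof -
    have "max_error n \<alpha> xbar \<alpha>0s \<beta>0s \<le> weighted_deviation n \<alpha> xbar \<alpha>0s / 2"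
      unfolding \<open>\<beta>0s = _\<close> by (rule max_error_midpoint) (rule nonneg)
    also have "\<dots> \<le> weighted_deviation n \<alpha> xbar a / 2"
      using weighted_deviation_minimal[OF assms(2) nonneg assms(4-6)] \<open>\<alpha>0s = _\<close> by simp
    also have "\<dots> \<le> max_error n \<alpha> xbar a b"
      by (rule max_error_lower_bound) (rule nonneg)
    finally show ?thesis .
  qed
  then show ?thesis
    by (auto simp: is_arg_min_def not_less)
qed

end
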